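(* Let $X$ be a sublattice of a uniformly complete vector lattice $Z$. Then the uniform completion $X^{\mathrm{ru}}$ of $X$ is lattice isomorphic to the intersection of all uniformly complete sublattices of $Z$ containing $X$; moreover, the isomorphism preserves $X$ (i.e., it restricts to the identity on $X$).
   Context: All vector lattices are real and Archimedean. For a vector lattice $X$ and $e\in X_+$, a net $(x_\alpha)$ in $X$ converges to $x\in X$ uniformly relative to $e$ if for every $\varepsilon>0$ there is $\alpha_0$ with $|x_\alpha-x|\le\varepsilon e$ for all $\alpha\ge\alpha_0$; it converges (relatively) uniformly to $x$ in $X$ if this holds for some $e\in X_+$ (called a regulator). A net $(x_\alpha)_{\alpha\in\Lambda}$ is uniformly Cauchy in $X$ if the net $(x_\alpha-x_\beta)$ indexed by $\Lambda^2$ converges uniformly to $0$ in $X$. $X$ is uniformly complete if every uniformly Cauchy net in $X$ converges uniformly in $X$. A sublattice is called uniformly complete if it is uniformly complete as a vector lattice in its own right. $X^\delta$ denotes the order (Dedekind) completion of $X$. The uniform completion $X^{\mathrm{ru}}$ of $X$ is the intersection of all uniformly complete sublattices of $X^\delta$ that contain $X$ (it is a uniformly complete sublattice of $X^\delta$ containing $X$). Sublattice means vector sublattice. *)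

theory Defs
  imports Complex_Main "HOL-Library.Lattice_Algebras"
begin

(* Throughout, a vector lattice is a vector sublattice S of a type of this class, regarded as a
   vector lattice in its own right; S = UNIV is the case of the whole type. A sublattice of S is
   then a vector sublattice of the type contained in S. *)
class archimedean_vector_lattice = ordered_real_vector + lattice_ab_group_add_abs +
  assumes archimedean: "0 \<le> x \<Longrightarrow> (\<And>n::nat. real n *\<^sub>R x \<le> y) \<Longrightarrow> x = 0"

definition vector_sublattice :: "'a::archimedean_vector_lattice set \<Rightarrow> bool" where
  "vector_sublattice S \<longleftrightarrow>
     subspace S \<and> (\<forall>x\<in>S. \<forall>y\<in>S. sup x y \<in> S \<and> inf x y \<in> S)"

definition lattice_hom_on ::
  "'a::archimedean_vector_lattice set \<Rightarrow> ('a \<Rightarrow> 'b::archimedean_vector_lattice) \<Rightarrow> bool" where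
  "lattice_hom_on S T \<longleftrightarrow>
     (\<forall>x\<in>S. \<forall>y\<in>S. T (x + y) = T x + T y) \<and>
     (\<forall>c. \<forall>x\<in>S. T (c *\<^sub>R x) = c *\<^sub>R T x) \<and>
     (\<forall>x\<in>S. \<forall>y\<in>S. T (sup x y) = sup (T x) (T y) \<and> T (inf x y) = inf (T x) (T y))"

definition lattice_iso_on ::
  "'a::archimedean_vector_lattice set \<Rightarrow> 'b::archimedean_vector_lattice set \<Rightarrow> ('a \<Rightarrow> 'b) \<Rightarrow> bool"
  where "lattice_iso_on S S' T \<longleftrightarrow> lattice_hom_on S T \<and> bij_betw T S S'"


definition directed_index :: "'i set \<Rightarrow> ('i \<Rightarrow> 'i \<Rightarrow> bool) \<Rightarrow> bool" where
  "directed_index \<Lambda> le \<longleftrightarrow> \<Lambda> \<noteq> {} \<and> reflp_on \<Lambda> le \<and> transp_on \<Lambda> le \<and>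
     (\<forall>\<alpha>\<in>\<Lambda>. \<forall>\<beta>\<in>\<Lambda>. \<exists>\<gamma>\<in>\<Lambda>. le \<alpha> \<gamma> \<and> le \<beta> \<gamma>)"

definition converges_rel ::
  "'a::archimedean_vector_lattice \<Rightarrow> 'i set \<Rightarrow> ('i \<Rightarrow> 'i \<Rightarrow> bool) \<Rightarrow> ('i \<Rightarrow> 'a) \<Rightarrow> 'a \<Rightarrow> bool" where
  "converges_rel e \<Lambda> le x l \<longleftrightarrow>
     (\<forall>\<epsilon>>0. \<exists>\<alpha>\<^sub>0\<in>\<Lambda>. \<forall>\<alpha>\<in>\<Lambda>. le \<alpha>\<^sub>0 \<alpha> \<longrightarrow> \<bar>x \<alpha> - l\<bar> \<le> \<epsilon> *\<^sub>R e)"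

(* The regulator has to lie in S, so uniform convergence depends on S. *)
definition converges_uniformly ::
  "'a::archimedean_vector_lattice set \<Rightarrow> 'i set \<Rightarrow> ('i \<Rightarrow> 'i \<Rightarrow> bool) \<Rightarrow> ('i \<Rightarrow> 'a) \<Rightarrow> 'a \<Rightarrow> bool" where
  "converges_uniformly S \<Lambda> le x l \<longleftrightarrow> (\<exists>e\<in>S. 0 \<le> e \<and> converges_rel e \<Lambda> le x l)"

definition uniformly_Cauchy ::
  "'a::archimedean_vector_lattice set \<Rightarrow> 'i set \<Rightarrow> ('i \<Rightarrow> 'i \<Rightarrow> bool) \<Rightarrow> ('i \<Rightarrow> 'a) \<Rightarrow> bool" where
  "uniformly_Cauchy S \<Lambda> le x \<longleftrightarrow>
     converges_uniformly S (\<Lambda> \<times> \<Lambda>) (rel_prod le le) (\<lambda>(\<alpha>, \<beta>). x \<alpha> - x \<beta>) 0"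

(* A definition cannot quantify over index types. The type 'a set * 'a is large enough to index
   a net with the same tails as any given net in 'a, so nothing is lost by fixing it: the lemma
   uniformly_completeD below covers nets over arbitrary index types. *)
definition uniformly_complete :: "'a::archimedean_vector_lattice set \<Rightarrow> bool" where
  "uniformly_complete S \<longleftrightarrow>
     (\<forall>(\<Lambda> :: ('a set \<times> 'a) set) le x.
        directed_index \<Lambda> le \<longrightarrow> x ` \<Lambda> \<subseteq> S \<longrightarrow> uniformly_Cauchy S \<Lambda> le x \<longrightarrow>
        (\<exists>l\<in>S. converges_uniformly S \<Lambda> le x l))"

lemma uniformly_completeD:
  fixes S :: "'a::archimedean_vector_lattice set" and \<Lambda> :: "'i set"
  assumes S: "uniformly_complete S" and dir: "directed_index \<Lambda> le"
    and xS: "x ` \<Lambda> \<subseteq> S" and C: "uniformly_Cauchy S \<Lambda> le x"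
  shows "\<exists>l\<in>S. converges_uniformly S \<Lambda> le x l"
proof -
  define tl where "tl \<alpha> = x ` {\<beta>\<in>\<Lambda>. le \<alpha> \<beta>}" for \<alpha>
  define \<Lambda>' where "\<Lambda>' = {(A, s). \<exists>\<alpha>\<in>\<Lambda>. A = tl \<alpha> \<and> s \<in> A}"
  define le' :: "'a set \<times> 'a \<Rightarrow> 'a set \<times> 'a \<Rightarrow> bool" where "le' p q \<longleftrightarrow> fst q \<subseteq> fst p" for p q
  have refl: "le \<alpha> \<alpha>" if "\<alpha> \<in> \<Lambda>" for \<alpha>
    using dir that by (auto simp: directed_index_def reflp_on_def)
  have trans: "le \<alpha> \<gamma>" if "le \<alpha> \<beta>" "le \<beta> \<gamma>" "\<alpha> \<in> \<Lambda>" "\<beta> \<in> \<Lambda>" "\<gamma> \<in> \<Lambda>" for \<alpha> \<beta> \<gamma>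
    using dir that unfolding directed_index_def transp_on_def by blast
  have in_tl: "x \<alpha> \<in> tl \<alpha>" if "\<alpha> \<in> \<Lambda>" for \<alpha>
    using refl that by (auto simp: tl_def)
  have tl_mono: "tl \<beta> \<subseteq> tl \<alpha>" if "le \<alpha> \<beta>" "\<alpha> \<in> \<Lambda>" "\<beta> \<in> \<Lambda>" for \<alpha> \<beta>
    using trans that unfolding tl_def by blast
  have \<Lambda>'I: "(tl \<alpha>, x \<alpha>) \<in> \<Lambda>'" if "\<alpha> \<in> \<Lambda>" for \<alpha>
    using in_tl that by (auto simp: \<Lambda>'_def)
  have dir': "directed_index \<Lambda>' le'"
    unfolding directed_index_def
  proof (intro conjI ballI)
    show "\<Lambda>' \<noteq> {}" using dir \<Lambda>'I by (auto simp: directed_index_def)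
    show "reflp_on \<Lambda>' le'" by (auto simp: reflp_on_def le'_def)
    show "transp_on \<Lambda>' le'" by (auto simp: transp_on_def le'_def)
    fix p q assume "p \<in> \<Lambda>'" "q \<in> \<Lambda>'"
    then obtain \<alpha> \<beta> where ab: "\<alpha> \<in> \<Lambda>" "\<beta> \<in> \<Lambda>" "fst p = tl \<alpha>" "fst q = tl \<beta>"
      by (auto simp: \<Lambda>'_def)
    then obtain \<gamma> where "\<gamma> \<in> \<Lambda>" "le \<alpha> \<gamma>" "le \<beta> \<gamma>"
      using dir unfolding directed_index_def by blast
    then show "\<exists>r\<in>\<Lambda>'. le' p r \<and> le' q r"
      using ab tl_mono \<Lambda>'I by (intro bexI[of _ "(tl \<gamma>, x \<gamma>)"]) (auto simp: le'_def)
  qed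
  have tail: "\<exists>\<beta>\<in>\<Lambda>. le \<alpha> \<beta> \<and> x \<beta> = snd p"
    if "p \<in> \<Lambda>'" "le' (tl \<alpha>, x \<alpha>) p" for \<alpha> p
    using that by (fastforce simp: \<Lambda>'_def le'_def tl_def)
  have xS': "snd ` \<Lambda>' \<subseteq> S"
    using xS by (auto simp: \<Lambda>'_def tl_def)
  obtain e where e: "e \<in> S" "0 \<le> e"
    and conv: "converges_rel e (\<Lambda> \<times> \<Lambda>) (rel_prod le le) (\<lambda>(\<alpha>, \<beta>). x \<alpha> - x \<beta>) 0"
    using C by (auto simp: uniformly_Cauchy_def converges_uniformly_def)
  have "converges_rel e (\<Lambda>' \<times> \<Lambda>') (rel_prod le' le') (\<lambda>(p, q). snd p - snd q) 0"
    unfolding converges_rel_def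
  proof (intro allI impI)
    fix \<epsilon> :: real assume "\<epsilon> > 0"
    then obtain \<alpha> \<beta> where ab: "\<alpha> \<in> \<Lambda>" "\<beta> \<in> \<Lambda>"
      and *: "\<And>\<alpha>' \<beta>'. \<alpha>' \<in> \<Lambda> \<Longrightarrow> \<beta>' \<in> \<Lambda> \<Longrightarrow> le \<alpha> \<alpha>' \<Longrightarrow> le \<beta> \<beta>' \<Longrightarrow> \<bar>x \<alpha>' - x \<beta>'\<bar> \<le> \<epsilon> *\<^sub>R e"
      using conv unfolding converges_rel_def by fastforce
    have "\<bar>snd p - snd q\<bar> \<le> \<epsilon> *\<^sub>R e"
      if "p \<in> \<Lambda>'" "q \<in> \<Lambda>'" "le' (tl \<alpha>, x \<alpha>) p" "le' (tl \<beta>, x \<beta>) q" for p q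
      using * tail that by metis
    then show "\<exists>r\<in>\<Lambda>' \<times> \<Lambda>'. \<forall>s\<in>\<Lambda>' \<times> \<Lambda>'. rel_prod le' le' r s \<longrightarrow>
        \<bar>(case s of (p, q) \<Rightarrow> snd p - snd q) - 0\<bar> \<le> \<epsilon> *\<^sub>R e"
      using ab \<Lambda>'I by (intro bexI[of _ "((tl \<alpha>, x \<alpha>), (tl \<beta>, x \<beta>))"]) auto
  qed
  then have "uniformly_Cauchy S \<Lambda>' le' snd"
    using e unfolding uniformly_Cauchy_def converges_uniformly_def by blast
  then obtain l e' where l: "l \<in> S" and e': "e' \<in> S" "0 \<le> e'"
    and conv': "converges_rel e' \<Lambda>' le' snd l"
    using S dir' xS' unfolding uniformly_complete_def converges_uniformly_def by blast
  have "converges_rel e' \<Lambda> le x l"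
    unfolding converges_rel_def
  proof (intro allI impI)
    fix \<epsilon> :: real assume "\<epsilon> > 0"
    then obtain p where p: "p \<in> \<Lambda>'"
      and *: "\<And>q. q \<in> \<Lambda>' \<Longrightarrow> le' p q \<Longrightarrow> \<bar>snd q - l\<bar> \<le> \<epsilon> *\<^sub>R e'"
      using conv' unfolding converges_rel_def by blast
    from p obtain \<alpha> where \<alpha>: "\<alpha> \<in> \<Lambda>" "fst p = tl \<alpha>"
      by (auto simp: \<Lambda>'_def)
    have "\<bar>x \<beta> - l\<bar> \<le> \<epsilon> *\<^sub>R e'" if "\<beta> \<in> \<Lambda>" "le \<alpha> \<beta>" for \<beta>
      using *[of "(tl \<beta>, x \<beta>)"] \<Lambda>'I tl_mono \<alpha> that by (auto simp: le'_def)
    then show "\<exists>\<alpha>\<^sub>0\<in>\<Lambda>. \<forall>\<alpha>\<in>\<Lambda>. le \<alpha>\<^sub>0 \<alpha> \<longrightarrow> \<bar>x \<alpha> - l\<bar> \<le> \<epsilon> *\<^sub>R e'"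
      using \<alpha> by blast
  qed
  then show ?thesis
    using l e' unfolding converges_uniformly_def by blast
qed


definition order_complete :: "'a::archimedean_vector_lattice set \<Rightarrow> bool" where
  "order_complete D \<longleftrightarrow>
     (\<forall>A\<subseteq>D. A \<noteq> {} \<longrightarrow> (\<exists>b\<in>D. \<forall>a\<in>A. a \<le> b) \<longrightarrow>
        (\<exists>s\<in>D. (\<forall>a\<in>A. a \<le> s) \<and> (\<forall>b\<in>D. (\<forall>a\<in>A. a \<le> b) \<longrightarrow> s \<le> b)))"

(* D, with the embedding j of X, is an order (Dedekind) completion of X: D is order complete and
   j identifies X with an order dense and majorizing sublattice of D. These properties determine
   (D, j) up to a lattice isomorphism compatible with the embeddings. *)
definition order_completion ::
  "'a::archimedean_vector_lattice set \<Rightarrow> 'b::archimedean_vector_lattice set \<Rightarrow> ('a \<Rightarrow> 'b) \<Rightarrow> bool" where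
  "order_completion X D j \<longleftrightarrow>
     vector_sublattice D \<and> order_complete D \<and>
     lattice_hom_on X j \<and> inj_on j X \<and> j ` X \<subseteq> D \<and>
     (\<forall>d\<in>D. 0 < d \<longrightarrow> (\<exists>x\<in>X. 0 < j x \<and> j x \<le> d)) \<and>
     (\<forall>d\<in>D. \<exists>x\<in>X. d \<le> j x)"

definition uniformly_complete_hull ::
  "'a::archimedean_vector_lattice set \<Rightarrow> 'a set \<Rightarrow> 'a set" where
  "uniformly_complete_hull Z X =
     \<Inter>{Y. vector_sublattice Y \<and> Y \<subseteq> Z \<and> uniformly_complete Y \<and> X \<subseteq> Y}"

(* The uniform completion of X, taken in the order completion (D, j), where X appears as j ` X. *)
definition uniform_completion ::
  "'a::archimedean_vector_lattice set \<Rightarrow> 'b::archimedean_vector_lattice set \<Rightarrow> ('a \<Rightarrow> 'b) \<Rightarrow> 'b set" where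
  "uniform_completion X D j = uniformly_complete_hull D (j ` X)"

end

theory Submission imports Defs begin

text \<open>
  Call the graph of the embedding of \<open>X\<close> into its order completion a correspondence \<open>G\<close> between
  \<open>D\<close> and \<open>Z\<close>, and let \<open>W\<close> be the least relation containing \<open>G\<close> and closed under
  simultaneous uniform limits in \<open>D\<close> and \<open>Z\<close> whose regulators form a pair of \<open>G\<close>. All of the
  structure of \<open>G\<close> passes to such limits: \<open>W\<close> is a sublattice of the product, and
  \<open>0 \<le> a \<longleftrightarrow> 0 \<le> b\<close> for every pair \<open>(a, b)\<close> in \<open>W\<close>, so \<open>W\<close> is the graph of a lattice
  isomorphism between its domain and its range. Since \<open>X\<close> is majorizing in both, every regulator
  there is dominated by one from \<open>X\<close>. Hence domain and range are uniformly complete, as \<open>D\<close> and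
  \<open>Z\<close> are, and they lie in every uniformly complete sublattice containing \<open>X\<close>: they are the two
  hulls.
\<close>

section \<open>Archimedean vector lattices\<close>

text \<open>The positive part of \<open>x - y\<close> stays below \<open>e\<close> divided by any
  positive \<open>n\<close>, so the Archimedean axiom makes it vanish. Every later passage to a
  limit removes its error term this way.\<close>

lemma archimedean_le:
  fixes x y e :: "'a::archimedean_vector_lattice"
  assumes e: "0 \<le> e" and le: "\<And>\<epsilon>. 0 < \<epsilon> \<Longrightarrow> x \<le> y + \<epsilon> *\<^sub>R e"
  shows "x \<le> y"
proof -
  define w where "w = sup (x - y) 0"
  have "real n *\<^sub>R w \<le> e" for n
  proof (cases "n = 0")
    case False
    then have "x - y \<le> (1 / real n) *\<^sub>R e"
      using le[of "1 / real n"] by (simp add: diff_le_eq add.commute)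
    then have "w \<le> (1 / real n) *\<^sub>R e"
      using e by (simp add: w_def scaleR_nonneg_nonneg)
    then have "real n *\<^sub>R w \<le> real n *\<^sub>R (1 / real n) *\<^sub>R e"
      by (intro scaleR_left_mono) auto
    then show ?thesis using False by simp
  qed (use e in simp)
  moreover have "0 \<le> w" by (simp add: w_def)
  ultimately have "w = 0" by (rule archimedean[rotated])
  then have "x - y \<le> 0" unfolding w_def by (metis sup_ge1)
  then show ?thesis by simp
qed

lemma abs_scaleR_lattice:
  fixes x :: "'a::archimedean_vector_lattice"
  shows "\<bar>c *\<^sub>R x\<bar> \<le> \<bar>c\<bar> *\<^sub>R \<bar>x\<bar>"
proof -
  have *: "\<bar>c *\<^sub>R x\<bar> \<le> c *\<^sub>R \<bar>x\<bar>" if "0 \<le> c" for c and x :: 'a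
  proof (rule abs_leI)
    show "c *\<^sub>R x \<le> c *\<^sub>R \<bar>x\<bar>" using that by (intro scaleR_left_mono abs_ge_self)
    have "c *\<^sub>R (- x) \<le> c *\<^sub>R \<bar>x\<bar>" using that by (intro scaleR_left_mono abs_ge_minus_self)
    then show "- (c *\<^sub>R x) \<le> c *\<^sub>R \<bar>x\<bar>" by simp
  qed
  show ?thesis
  proof (cases "0 \<le> c")
    case True then show ?thesis using *[of c x] by simp
  next
    case False then show ?thesis using *[of "- c" x] by simp
  qed
qed

text \<open>The factor \<open>\<bar>r\<bar>\<close> goes to the regulator and \<epsilon> stays the
  same, which fits the rule \<open>limit\<close> of \<open>uniform_closure\<close>.\<close>

lemma abs_scaleR_diff_le:
  fixes x y w :: "'a::archimedean_vector_lattice"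
  assumes "\<bar>x - y\<bar> \<le> \<epsilon> *\<^sub>R w"
  shows "\<bar>r *\<^sub>R x - r *\<^sub>R y\<bar> \<le> \<epsilon> *\<^sub>R \<bar>r\<bar> *\<^sub>R w"
proof -
  have "\<bar>r *\<^sub>R (x - y)\<bar> \<le> \<bar>r\<bar> *\<^sub>R \<bar>x - y\<bar>" by (rule abs_scaleR_lattice)
  also have "\<dots> \<le> \<bar>r\<bar> *\<^sub>R \<epsilon> *\<^sub>R w" using assms by (intro scaleR_left_mono) auto
  finally show ?thesis by (simp add: scaleR_right_diff_distrib mult.commute)
qed

text \<open>Since \<open>sup\<close> is nonexpansive in one argument, it passes to uniform limits
  without a change of regulator.\<close>

lemma abs_sup_diff_le:
  fixes x y z :: "'a::archimedean_vector_lattice"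
  shows "\<bar>sup x z - sup y z\<bar> \<le> \<bar>x - y\<bar>"
proof -
  have *: "sup x z \<le> sup y z + \<bar>x - y\<bar>" for x y :: 'a
  proof (rule sup_least)
    have "x \<le> y + \<bar>x - y\<bar>" using abs_ge_self[of "x - y"] by (simp only: diff_le_eq add.commute)
    also have "\<dots> \<le> sup y z + \<bar>x - y\<bar>" by simp
    finally show "x \<le> sup y z + \<bar>x - y\<bar>" .
    have "z + 0 \<le> sup y z + \<bar>x - y\<bar>" by (intro add_mono) auto
    then show "z \<le> sup y z + \<bar>x - y\<bar>" by simp
  qed
  show ?thesis
  proof (rule abs_leI)
    show "sup x z - sup y z \<le> \<bar>x - y\<bar>"
      using *[of x y] by (simp only: diff_le_eq add.commute)
    show "- (sup x z - sup y z) \<le> \<bar>x - y\<bar>"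
      using *[of y x] by (simp only: minus_diff_eq diff_le_eq add.commute abs_minus_commute)
  qed
qed

lemma abs_diff_le_add:
  fixes x y z :: "'a::archimedean_vector_lattice"
  assumes "\<bar>x - y\<bar> \<le> s" "\<bar>y - z\<bar> \<le> t"
  shows "\<bar>x - z\<bar> \<le> s + t"
proof -
  have "\<bar>x - z\<bar> = \<bar>(x - y) + (y - z)\<bar>" by simp
  also have "\<dots> \<le> \<bar>x - y\<bar> + \<bar>y - z\<bar>" by (rule abs_triangle_ineq)
  also have "\<dots> \<le> s + t" using assms by (rule add_mono)
  finally show ?thesis .
qed

lemma abs_diff_eq_zero:
  fixes x y e :: "'a::archimedean_vector_lattice"
  assumes "0 \<le> e" "\<And>\<epsilon>. 0 < \<epsilon> \<Longrightarrow> \<bar>x - y\<bar> \<le> \<epsilon> *\<^sub>R e"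
  shows "x = y"
proof -
  have "\<bar>x - y\<bar> \<le> 0" using archimedean_le[OF assms(1), of "\<bar>x - y\<bar>" 0] assms(2) by simp
  then show ?thesis by simp
qed

section \<open>Uniform completeness\<close>

text \<open>The regulator is a parameter, so that it can be kept track of, and one tail of the net
  replaces the two tails of the product index.\<close>

definition Cauchy_rel ::
  "'a::archimedean_vector_lattice \<Rightarrow> 'i set \<Rightarrow> ('i \<Rightarrow> 'i \<Rightarrow> bool) \<Rightarrow> ('i \<Rightarrow> 'a) \<Rightarrow> bool" where
  "Cauchy_rel e \<Lambda> le x \<longleftrightarrow>
     (\<forall>\<epsilon>>0. \<exists>\<alpha>\<in>\<Lambda>. \<forall>\<beta>\<in>\<Lambda>. \<forall>\<gamma>\<in>\<Lambda>. le \<alpha> \<beta> \<longrightarrow> le \<alpha> \<gamma> \<longrightarrow> \<bar>x \<beta> - x \<gamma>\<bar> \<le> \<epsilon> *\<^sub>R e)"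

lemma directed_indexD:
  assumes "directed_index \<Lambda> le"
  shows "\<alpha> \<in> \<Lambda> \<Longrightarrow> le \<alpha> \<alpha>"
    and "\<alpha> \<in> \<Lambda> \<Longrightarrow> \<beta> \<in> \<Lambda> \<Longrightarrow> \<gamma> \<in> \<Lambda> \<Longrightarrow> le \<alpha> \<beta> \<Longrightarrow> le \<beta> \<gamma> \<Longrightarrow> le \<alpha> \<gamma>"
    and "\<alpha> \<in> \<Lambda> \<Longrightarrow> \<beta> \<in> \<Lambda> \<Longrightarrow> \<exists>\<gamma>\<in>\<Lambda>. le \<alpha> \<gamma> \<and> le \<beta> \<gamma>"
  using assms unfolding directed_index_def reflp_on_def transp_on_def by blast+

text \<open>Directedness merges the two tail indices of the product net into one.\<close>

lemma uniformly_Cauchy_iff: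
  assumes dir: "directed_index \<Lambda> le"
  shows "uniformly_Cauchy S \<Lambda> le x \<longleftrightarrow> (\<exists>e\<in>S. 0 \<le> e \<and> Cauchy_rel e \<Lambda> le x)"
proof -
  have "converges_rel e (\<Lambda> \<times> \<Lambda>) (rel_prod le le) (\<lambda>(\<alpha>, \<beta>). x \<alpha> - x \<beta>) 0
      \<longleftrightarrow> Cauchy_rel e \<Lambda> le x" (is "?C \<longleftrightarrow> _") for e
  proof
    assume C: ?C
    show "Cauchy_rel e \<Lambda> le x"
      unfolding Cauchy_rel_def
    proof (intro allI impI)
      fix \<epsilon> :: real assume "\<epsilon> > 0"
      then obtain \<alpha> \<beta> where ab: "\<alpha> \<in> \<Lambda>" "\<beta> \<in> \<Lambda>"
        and *: "\<And>\<alpha>' \<beta>'. \<alpha>' \<in> \<Lambda> \<Longrightarrow> \<beta>' \<in> \<Lambda> \<Longrightarrow> le \<alpha> \<alpha>' \<Longrightarrow> le \<beta> \<beta>' \<Longrightarrow> \<bar>x \<alpha>' - x \<beta>'\<bar> \<le> \<epsilon> *\<^sub>R e"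
        using C unfolding converges_rel_def by fastforce
      obtain \<gamma> where g: "\<gamma> \<in> \<Lambda>" "le \<alpha> \<gamma>" "le \<beta> \<gamma>"
        using directed_indexD(3)[OF dir ab] by blast
      have "\<bar>x \<delta> - x \<zeta>\<bar> \<le> \<epsilon> *\<^sub>R e" if "\<delta> \<in> \<Lambda>" "\<zeta> \<in> \<Lambda>" "le \<gamma> \<delta>" "le \<gamma> \<zeta>" for \<delta> \<zeta>
        using that ab g * directed_indexD(2)[OF dir] by meson
      then show "\<exists>\<alpha>\<in>\<Lambda>. \<forall>\<beta>\<in>\<Lambda>. \<forall>\<gamma>\<in>\<Lambda>. le \<alpha> \<beta> \<longrightarrow> le \<alpha> \<gamma> \<longrightarrow> \<bar>x \<beta> - x \<gamma>\<bar> \<le> \<epsilon> *\<^sub>R e"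
        using g by blast
    qed
  next
    assume C: "Cauchy_rel e \<Lambda> le x"
    show ?C
      unfolding converges_rel_def
    proof (intro allI impI)
      fix \<epsilon> :: real assume "\<epsilon> > 0"
      then obtain \<alpha> where "\<alpha> \<in> \<Lambda>"
        "\<And>\<beta> \<gamma>. \<beta> \<in> \<Lambda> \<Longrightarrow> \<gamma> \<in> \<Lambda> \<Longrightarrow> le \<alpha> \<beta> \<Longrightarrow> le \<alpha> \<gamma> \<Longrightarrow> \<bar>x \<beta> - x \<gamma>\<bar> \<le> \<epsilon> *\<^sub>R e"
        using C unfolding Cauchy_rel_def by meson
      then show "\<exists>r\<in>\<Lambda> \<times> \<Lambda>. \<forall>s\<in>\<Lambda> \<times> \<Lambda>. rel_prod le le r s \<longrightarrow>
          \<bar>(case s of (\<alpha>, \<beta>) \<Rightarrow> x \<alpha> - x \<beta>) - 0\<bar> \<le> \<epsilon> *\<^sub>R e"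
        by (intro bexI[of _ "(\<alpha>, \<alpha>)"]) auto
    qed
  qed
  then show ?thesis
    by (simp add: uniformly_Cauchy_def converges_uniformly_def)
qed

lemma Cauchy_rel_mono:
  assumes "Cauchy_rel e \<Lambda> le x" "e \<le> u"
  shows "Cauchy_rel u \<Lambda> le x"
proof -
  have "\<epsilon> *\<^sub>R e \<le> \<epsilon> *\<^sub>R u" if "0 < \<epsilon>" for \<epsilon>
    using that assms(2) by (intro scaleR_left_mono) auto
  then show ?thesis
    using assms(1) unfolding Cauchy_rel_def by (meson order_trans)
qed

text \<open>Uniform completeness yields a limit with some uncontrolled regulator \<open>f\<close>.
  Letting the second index of the Cauchy estimate run to the limit costs an error \<delta> times
  \<open>f\<close>, which \<open>archimedean_le\<close> removes; so the Cauchy regulator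
  \<open>e\<close> also governs the convergence.\<close>

lemma converges_rel_Cauchy:
  assumes dir: "directed_index \<Lambda> le" and C: "Cauchy_rel e \<Lambda> le x"
    and f: "0 \<le> f" and l: "converges_rel f \<Lambda> le x l"
  shows "converges_rel e \<Lambda> le x l"
  unfolding converges_rel_def
proof (intro allI impI)
  fix \<epsilon> :: real assume "\<epsilon> > 0"
  then obtain \<alpha> where a: "\<alpha> \<in> \<Lambda>"
    and *: "\<And>\<beta> \<gamma>. \<beta> \<in> \<Lambda> \<Longrightarrow> \<gamma> \<in> \<Lambda> \<Longrightarrow> le \<alpha> \<beta> \<Longrightarrow> le \<alpha> \<gamma> \<Longrightarrow> \<bar>x \<beta> - x \<gamma>\<bar> \<le> \<epsilon> *\<^sub>R e"
    using C unfolding Cauchy_rel_def by meson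
  have "\<bar>x \<beta> - l\<bar> \<le> \<epsilon> *\<^sub>R e" if b: "\<beta> \<in> \<Lambda>" "le \<alpha> \<beta>" for \<beta>
  proof (rule archimedean_le[OF f])
    fix \<delta> :: real assume "\<delta> > 0"
    then obtain \<gamma> where g: "\<gamma> \<in> \<Lambda>" "\<And>\<zeta>. \<zeta> \<in> \<Lambda> \<Longrightarrow> le \<gamma> \<zeta> \<Longrightarrow> \<bar>x \<zeta> - l\<bar> \<le> \<delta> *\<^sub>R f"
      using l unfolding converges_rel_def by meson
    obtain \<zeta> where "\<zeta> \<in> \<Lambda>" "le \<alpha> \<zeta>" "le \<gamma> \<zeta>"
      using directed_indexD(3)[OF dir a g(1)] by blast
    then show "\<bar>x \<beta> - l\<bar> \<le> \<epsilon> *\<^sub>R e + \<delta> *\<^sub>R f"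
      using * g b by (intro abs_diff_le_add) auto
  qed
  then show "\<exists>\<alpha>\<in>\<Lambda>. \<forall>\<beta>\<in>\<Lambda>. le \<alpha> \<beta> \<longrightarrow> \<bar>x \<beta> - l\<bar> \<le> \<epsilon> *\<^sub>R e"
    using a by blast
qed

lemma uniformly_complete_Cauchy_rel:
  fixes S :: "'a::archimedean_vector_lattice set" and \<Lambda> :: "'i set"
  assumes S: "uniformly_complete S" and dir: "directed_index \<Lambda> le" and xS: "x ` \<Lambda> \<subseteq> S"
    and e: "e \<in> S" "0 \<le> e" and C: "Cauchy_rel e \<Lambda> le x"
  shows "\<exists>l\<in>S. converges_rel e \<Lambda> le x l"
proof -
  have "uniformly_Cauchy S \<Lambda> le x"
    using e C uniformly_Cauchy_iff[OF dir] by blast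
  then obtain l f where "l \<in> S" "0 \<le> f" "converges_rel f \<Lambda> le x l"
    using uniformly_completeD[OF S dir xS] unfolding converges_uniformly_def by blast
  then show ?thesis
    using converges_rel_Cauchy[OF dir C] by blast
qed

text \<open>The regulator \<open>u\<close> of the limit may differ from \<open>e\<close>: for the
  domain of the closure, \<open>e\<close> is first enlarged to an element coming from
  \<open>G\<close>.\<close>

lemma uniformly_completeI:
  fixes S :: "'a::archimedean_vector_lattice set"
  assumes "\<And>(\<Lambda> :: ('a set \<times> 'a) set) le x e. directed_index \<Lambda> le \<Longrightarrow> x ` \<Lambda> \<subseteq> S \<Longrightarrow> e \<in> S \<Longrightarrow>
      0 \<le> e \<Longrightarrow> Cauchy_rel e \<Lambda> le x \<Longrightarrow> \<exists>l\<in>S. \<exists>u\<in>S. 0 \<le> u \<and> converges_rel u \<Lambda> le x l"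
  shows "uniformly_complete S"
  unfolding uniformly_complete_def converges_uniformly_def
proof (intro allI impI)
  fix \<Lambda> :: "('a set \<times> 'a) set" and le x
  assume dir: "directed_index \<Lambda> le" and x: "x ` \<Lambda> \<subseteq> S" and "uniformly_Cauchy S \<Lambda> le x"
  then obtain e where "e \<in> S" "0 \<le> e" "Cauchy_rel e \<Lambda> le x"
    using uniformly_Cauchy_iff by blast
  then show "\<exists>l\<in>S. \<exists>u\<in>S. 0 \<le> u \<and> converges_rel u \<Lambda> le x l"
    by (rule assms[OF dir x])
qed

text \<open>Approximants with errors \<open>1 / real (Suc n)\<close> form a Cauchy sequence in
  \<open>S\<close>; its limit in \<open>S\<close> must be \<open>a\<close>, as uniform limits are
  unique. Here \<open>a\<close> is any element of the ambient lattice, so this is a closedness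
  property of \<open>S\<close>.\<close>

lemma uniformly_complete_approx:
  fixes S :: "'a::archimedean_vector_lattice set"
  assumes S: "uniformly_complete S" and e: "e \<in> S" "0 \<le> e"
    and approx: "\<And>\<epsilon>. 0 < \<epsilon> \<Longrightarrow> \<exists>y\<in>S. \<bar>a - y\<bar> \<le> \<epsilon> *\<^sub>R e"
  shows "a \<in> S"
proof -
  have "\<exists>y\<in>S. \<bar>a - y\<bar> \<le> (1 / real (Suc n)) *\<^sub>R e" for n
    using approx by simp
  then obtain y where y: "\<And>n. y n \<in> S" "\<And>n. \<bar>a - y n\<bar> \<le> (1 / real (Suc n)) *\<^sub>R e"
    by metis
  have close: "\<bar>a - y n\<bar> \<le> \<epsilon> *\<^sub>R e" if "1 / real (Suc N) < \<epsilon>" "N \<le> n" for n N \<epsilon>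
  proof -
    have "1 / real (Suc n) \<le> 1 / real (Suc N)" using that by (simp add: frac_le)
    then have "(1 / real (Suc n)) *\<^sub>R e \<le> \<epsilon> *\<^sub>R e"
      using that e by (intro scaleR_right_mono) auto
    then show ?thesis using y(2) order_trans by blast
  qed
  have dir: "directed_index (UNIV :: nat set) (\<le>)"
    by (auto simp: directed_index_def reflp_on_def transp_on_def intro: max.cobounded1 max.cobounded2)
  have conv: "converges_rel e UNIV (\<le>) y a"
    unfolding converges_rel_def
    using close by (metis UNIV_I abs_minus_commute nat_approx_posE)
  have "Cauchy_rel e UNIV (\<le>) y"
    unfolding Cauchy_rel_def
  proof (intro allI impI)
    fix \<epsilon> :: real assume "\<epsilon> > 0"
    then obtain N where N: "1 / real (Suc N) < \<epsilon> / 2"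
      using nat_approx_posE[of "\<epsilon> / 2"] by auto
    have "\<bar>y m - y n\<bar> \<le> \<epsilon> *\<^sub>R e" if "N \<le> m" "N \<le> n" for m n
      using abs_diff_le_add[of "y m" a "(\<epsilon> / 2) *\<^sub>R e" "y n" "(\<epsilon> / 2) *\<^sub>R e"] close[OF N] that
      by (simp add: abs_minus_commute flip: scaleR_left_distrib)
    then show "\<exists>\<alpha>\<in>UNIV. \<forall>\<beta>\<in>UNIV. \<forall>\<gamma>\<in>UNIV. \<alpha> \<le> \<beta> \<longrightarrow> \<alpha> \<le> \<gamma> \<longrightarrow> \<bar>y \<beta> - y \<gamma>\<bar> \<le> \<epsilon> *\<^sub>R e"
      by blast
  qed
  then obtain l where l: "l \<in> S" "converges_rel e UNIV (\<le>) y l"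
    using uniformly_complete_Cauchy_rel[OF S dir _ e] y(1) by blast
  \<comment> \<open>The regulator is doubled because \<open>a\<close> and \<open>l\<close> are each
    one error \<epsilon> times \<open>e\<close> away from a common late term.\<close>
  have "a = l"
  proof (rule abs_diff_eq_zero[of "2 *\<^sub>R e"])
    show "0 \<le> 2 *\<^sub>R e" using e by (simp add: scaleR_nonneg_nonneg)
    fix \<epsilon> :: real assume "\<epsilon> > 0"
    then obtain m n where "\<And>k. m \<le> k \<Longrightarrow> \<bar>y k - a\<bar> \<le> \<epsilon> *\<^sub>R e" "\<And>k. n \<le> k \<Longrightarrow> \<bar>y k - l\<bar> \<le> \<epsilon> *\<^sub>R e"
      using conv l(2) unfolding converges_rel_def by (metis UNIV_I)
    then have "\<bar>a - y (max m n)\<bar> \<le> \<epsilon> *\<^sub>R e" "\<bar>y (max m n) - l\<bar> \<le> \<epsilon> *\<^sub>R e"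
      by (simp_all add: abs_minus_commute)
    from abs_diff_le_add[OF this] show "\<bar>a - l\<bar> \<le> \<epsilon> *\<^sub>R 2 *\<^sub>R e"
      by (simp add: scaleR_2 scaleR_right_distrib)
  qed
  then show ?thesis using l by simp
qed

lemma vector_sublatticeD:
  assumes "vector_sublattice S"
  shows "0 \<in> S" "x \<in> S \<Longrightarrow> y \<in> S \<Longrightarrow> x + y \<in> S" "x \<in> S \<Longrightarrow> c *\<^sub>R x \<in> S"
    "x \<in> S \<Longrightarrow> y \<in> S \<Longrightarrow> x - y \<in> S"
    "x \<in> S \<Longrightarrow> y \<in> S \<Longrightarrow> sup x y \<in> S" "x \<in> S \<Longrightarrow> y \<in> S \<Longrightarrow> inf x y \<in> S"
  using assms unfolding vector_sublattice_def
  by (auto intro: subspace_0 subspace_add subspace_scale subspace_diff)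

text \<open>Good stages of the net give lower and upper estimates for the limit. The supremum of the
  lower estimates lies between all of them, hence is the limit.\<close>

lemma order_complete_uniformly_complete:
  fixes S :: "'a::archimedean_vector_lattice set"
  assumes S: "vector_sublattice S" and oc: "order_complete S"
  shows "uniformly_complete S"
proof (rule uniformly_completeI)
  fix \<Lambda> :: "('a set \<times> 'a) set" and le x e
  assume dir: "directed_index \<Lambda> le" and xS: "x ` \<Lambda> \<subseteq> S" and e: "e \<in> S" "0 \<le> e"
    and C: "Cauchy_rel e \<Lambda> le x"
  define close where "close \<epsilon> \<alpha> \<longleftrightarrow> \<alpha> \<in> \<Lambda> \<and> (\<forall>\<beta>\<in>\<Lambda>. le \<alpha> \<beta> \<longrightarrow> \<bar>x \<alpha> - x \<beta>\<bar> \<le> \<epsilon> *\<^sub>R e)" for \<epsilon> :: real and \<alpha>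
  define L where "L = {x \<alpha> - \<epsilon> *\<^sub>R e | \<epsilon> \<alpha>. close \<epsilon> \<alpha>}"
  \<comment> \<open>Every lower estimate is below every upper one: both are compared with the term
    at a common later index.\<close>
  have bound: "x \<alpha> - \<epsilon> *\<^sub>R e \<le> x \<beta> + \<delta> *\<^sub>R e" if ab: "close \<epsilon> \<alpha>" "close \<delta> \<beta>" for \<alpha> \<beta> \<epsilon> \<delta>
  proof -
    obtain \<gamma> where "\<gamma> \<in> \<Lambda>" "le \<alpha> \<gamma>" "le \<beta> \<gamma>"
      using directed_indexD(3)[OF dir] ab unfolding close_def by meson
    then have "\<bar>x \<alpha> - x \<gamma>\<bar> \<le> \<epsilon> *\<^sub>R e" "\<bar>x \<gamma> - x \<beta>\<bar> \<le> \<delta> *\<^sub>R e"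
      using ab by (auto simp: close_def abs_minus_commute)
    from abs_diff_le_add[OF this] have "x \<alpha> - x \<beta> \<le> \<epsilon> *\<^sub>R e + \<delta> *\<^sub>R e"
      by (rule abs_le_D1)
    then show ?thesis by (simp add: algebra_simps)
  qed
  have ex: "\<exists>\<alpha>\<in>\<Lambda>. \<forall>\<beta>\<in>\<Lambda>. le \<alpha> \<beta> \<longrightarrow> close \<epsilon> \<beta>" if eps: "0 < \<epsilon>" for \<epsilon>
  proof -
    obtain \<alpha> where \<alpha>: "\<alpha> \<in> \<Lambda>"
      "\<And>\<beta> \<gamma>. \<beta> \<in> \<Lambda> \<Longrightarrow> \<gamma> \<in> \<Lambda> \<Longrightarrow> le \<alpha> \<beta> \<Longrightarrow> le \<alpha> \<gamma> \<Longrightarrow> \<bar>x \<beta> - x \<gamma>\<bar> \<le> \<epsilon> *\<^sub>R e"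
      using C eps unfolding Cauchy_rel_def by meson
    have "close \<epsilon> \<beta>" if \<beta>: "\<beta> \<in> \<Lambda>" "le \<alpha> \<beta>" for \<beta>
      unfolding close_def
    proof (intro conjI ballI impI)
      fix \<gamma> assume \<gamma>: "\<gamma> \<in> \<Lambda>" "le \<beta> \<gamma>"
      then have "le \<alpha> \<gamma>"
        using directed_indexD(2)[OF dir \<alpha>(1) \<beta>(1) \<gamma>(1) \<beta>(2)] by blast
      then show "\<bar>x \<beta> - x \<gamma>\<bar> \<le> \<epsilon> *\<^sub>R e"
        using \<alpha> \<beta> \<gamma> by blast
    qed (rule \<beta>(1))
    then show ?thesis using \<alpha>(1) by blast
  qed
  obtain \<alpha> where a: "close 1 \<alpha>"
    using ex[of 1] directed_indexD(1)[OF dir] by auto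
  have xS': "x \<beta> \<in> S" if "close \<epsilon> \<beta>" for \<epsilon> \<beta>
    using xS that by (auto simp: close_def)
  have "L \<subseteq> S"
    unfolding L_def using xS' e(1) by (blast intro: vector_sublatticeD(3,4)[OF S])
  moreover have "L \<noteq> {}" using a unfolding L_def by blast
  \<comment> \<open>A single upper estimate, at accuracy 1, bounds all of \<open>L\<close>.\<close>
  moreover have "\<exists>b\<in>S. \<forall>a\<in>L. a \<le> b"
  proof
    show "\<forall>b\<in>L. b \<le> x \<alpha> + 1 *\<^sub>R e"
      using bound[OF _ a] unfolding L_def by blast
    show "x \<alpha> + 1 *\<^sub>R e \<in> S"
      by (intro vector_sublatticeD[OF S] xS'[OF a] e(1))
  qed
  ultimately have "\<exists>s\<in>S. (\<forall>a\<in>L. a \<le> s) \<and> (\<forall>b\<in>S. (\<forall>a\<in>L. a \<le> b) \<longrightarrow> s \<le> b)"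
    by (rule oc[unfolded order_complete_def, THEN spec, THEN mp, THEN mp, THEN mp])
  then obtain s where s: "s \<in> S" "\<And>a. a \<in> L \<Longrightarrow> a \<le> s"
    "\<And>b. b \<in> S \<Longrightarrow> (\<And>a. a \<in> L \<Longrightarrow> a \<le> b) \<Longrightarrow> s \<le> b"
    by blast
  have "\<bar>x \<beta> - s\<bar> \<le> \<epsilon> *\<^sub>R e" if "close \<epsilon> \<beta>" for \<epsilon> \<beta>
  proof (rule abs_leI)
    have "x \<beta> - \<epsilon> *\<^sub>R e \<le> s" using that s(2) unfolding L_def by blast
    then show "x \<beta> - s \<le> \<epsilon> *\<^sub>R e" by (simp add: algebra_simps)
    have "s \<le> x \<beta> + \<epsilon> *\<^sub>R e"
    proof (rule s(3))
      show "x \<beta> + \<epsilon> *\<^sub>R e \<in> S"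
        by (intro vector_sublatticeD[OF S] xS'[OF that] e(1))
      show "a \<le> x \<beta> + \<epsilon> *\<^sub>R e" if "a \<in> L" for a
        using that bound[OF _ \<open>close \<epsilon> \<beta>\<close>] unfolding L_def by blast
    qed
    then show "- (x \<beta> - s) \<le> \<epsilon> *\<^sub>R e" by (simp add: algebra_simps)
  qed
  then have "converges_rel e \<Lambda> le x s"
    unfolding converges_rel_def using ex by blast
  then show "\<exists>l\<in>S. \<exists>u\<in>S. 0 \<le> u \<and> converges_rel u \<Lambda> le x l"
    using s(1) e by blast
qed

section \<open>Uniform closure of a correspondence\<close>

text \<open>One approximating pair and one \<epsilon> serve both coordinates, and the regulators
  correspond under \<open>G\<close>; this ties the two limits together. Being inductive, the closure
  contains iterated limits, while each proof about it treats a single limit step.\<close>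

inductive_set uniform_closure ::
  "'a::archimedean_vector_lattice set \<Rightarrow> 'b::archimedean_vector_lattice set \<Rightarrow> ('a \<times> 'b) set \<Rightarrow>
    ('a \<times> 'b) set"
  for D Z G where
  base: "(a, b) \<in> G \<Longrightarrow> (a, b) \<in> uniform_closure D Z G"
| limit: "\<lbrakk>a \<in> D; b \<in> Z; (u, v) \<in> G; 0 \<le> u; 0 \<le> v;
    \<And>\<epsilon>::real. 0 < \<epsilon> \<Longrightarrow> \<exists>a' b'. (a', b') \<in> uniform_closure D Z G \<and>
      \<bar>a - a'\<bar> \<le> \<epsilon> *\<^sub>R u \<and> \<bar>b - b'\<bar> \<le> \<epsilon> *\<^sub>R v\<rbrakk>
    \<Longrightarrow> (a, b) \<in> uniform_closure D Z G"

lemma uniform_closure_converse_aux: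
  assumes "(a, b) \<in> uniform_closure D Z G"
  shows "(b, a) \<in> uniform_closure Z D (G\<inverse>)"
  using assms
proof induction
  case (base a b)
  then show ?case by (auto intro: uniform_closure.base)
next
  case (limit a b u v)
  show ?case
  proof (rule uniform_closure.limit[of b Z a D v u])
    fix \<epsilon> :: real assume "\<epsilon> > 0"
    then show "\<exists>b' a'. (b', a') \<in> uniform_closure Z D (G\<inverse>) \<and>
        \<bar>b - b'\<bar> \<le> \<epsilon> *\<^sub>R v \<and> \<bar>a - a'\<bar> \<le> \<epsilon> *\<^sub>R u"
      using limit.IH by blast
  qed (use limit.hyps in auto)
qed

text \<open>This turns results about the domain of the closure into results about its range.\<close>

lemma uniform_closure_converse: "uniform_closure Z D (G\<inverse>) = (uniform_closure D Z G)\<inverse>"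
  using uniform_closure_converse_aux[of _ _ D Z G] uniform_closure_converse_aux[of _ _ Z D "G\<inverse>"]
  by auto

text \<open>The assumptions are symmetric in \<open>D\<close> and \<open>Z\<close>, so every
  consequence can be used for \<open>G\<inverse>\<close> too. The equivalence
  \<open>G_nonneg\<close> encodes an injective lattice homomorphism as a relation: it yields
  single-valuedness in both directions.\<close>

locale lattice_correspondence =
  fixes D :: "'a::archimedean_vector_lattice set" and Z :: "'b::archimedean_vector_lattice set"
    and G :: "('a \<times> 'b) set"
  assumes D: "vector_sublattice D" and Z: "vector_sublattice Z"
    and D_complete: "uniformly_complete D" and Z_complete: "uniformly_complete Z"
    and G_subset: "G \<subseteq> D \<times> Z"
    and G_zero: "(0, 0) \<in> G"
    and G_add: "(a, b) \<in> G \<Longrightarrow> (c, d) \<in> G \<Longrightarrow> (a + c, b + d) \<in> G"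
    and G_scale: "(a, b) \<in> G \<Longrightarrow> (r *\<^sub>R a, r *\<^sub>R b) \<in> G"
    and G_sup: "(a, b) \<in> G \<Longrightarrow> (c, d) \<in> G \<Longrightarrow> (sup a c, sup b d) \<in> G"
    and G_nonneg: "(a, b) \<in> G \<Longrightarrow> 0 \<le> a \<longleftrightarrow> 0 \<le> b"
begin

section \<open>Lattice operations and order on the uniform closure\<close>

abbreviation W where "W \<equiv> uniform_closure D Z G"

lemma converse_correspondence: "lattice_correspondence Z D (G\<inverse>)"
  by unfold_locales
    (use D Z D_complete Z_complete G_subset G_zero in
      \<open>auto intro: G_add G_scale G_sup dest: G_nonneg\<close>)

lemma W_subset: "(a, b) \<in> W \<Longrightarrow> a \<in> D \<and> b \<in> Z"
  by (erule uniform_closure.cases) (use G_subset in blast)+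

text \<open>A double induction, one argument at a time: the Lipschitz bounds keep the regulators
  unchanged, and commutativity exchanges the arguments.\<close>

lemma W_binop:
  fixes f :: "'a \<Rightarrow> 'a \<Rightarrow> 'a" and g :: "'b \<Rightarrow> 'b \<Rightarrow> 'b"
  assumes G_op: "\<And>a b c d. (a, b) \<in> G \<Longrightarrow> (c, d) \<in> G \<Longrightarrow> (f a c, g b d) \<in> G"
    and D_op: "\<And>a c. a \<in> D \<Longrightarrow> c \<in> D \<Longrightarrow> f a c \<in> D"
    and Z_op: "\<And>b d. b \<in> Z \<Longrightarrow> d \<in> Z \<Longrightarrow> g b d \<in> Z"
    and comm: "\<And>a c. f a c = f c a" "\<And>b d. g b d = g d b"
    and lip: "\<And>a a' c. \<bar>f a c - f a' c\<bar> \<le> \<bar>a - a'\<bar>" "\<And>b b' d. \<bar>g b d - g b' d\<bar> \<le> \<bar>b - b'\<bar>"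
    and ab: "(a, b) \<in> W" and cd: "(c, d) \<in> W"
  shows "(f a c, g b d) \<in> W"
proof -
  have extend: "(f a c, g b d) \<in> W"
    if "(a, b) \<in> W" and base: "\<And>a b. (a, b) \<in> G \<Longrightarrow> (f a c, g b d) \<in> W"
      and cd: "c \<in> D" "d \<in> Z" for a b c d
    using that(1)
  proof induction
    case (base a b)
    then show ?case by (rule that(2))
  next
    case (limit a b u v)
    show ?case
    proof (rule uniform_closure.limit[of _ _ _ _ u v])
      fix \<epsilon> :: real assume "\<epsilon> > 0"
      then obtain a' b' where "(f a' c, g b' d) \<in> W" "\<bar>a - a'\<bar> \<le> \<epsilon> *\<^sub>R u" "\<bar>b - b'\<bar> \<le> \<epsilon> *\<^sub>R v"
        using limit.IH by blast
      then show "\<exists>a' b'. (a', b') \<in> W \<and> \<bar>f a c - a'\<bar> \<le> \<epsilon> *\<^sub>R u \<and> \<bar>g b d - b'\<bar> \<le> \<epsilon> *\<^sub>R v"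
        using lip order_trans by meson
    qed (use limit cd D_op Z_op in auto)
  qed
  \<comment> \<open>First \<open>(c, d)\<close> ranges over the closure with the other pair still in
    \<open>G\<close>; this is the base case for then extending in \<open>(a, b)\<close>.\<close>
  have WG: "(f c a, g d b) \<in> W" if "(a, b) \<in> G" for a b
  proof (rule extend[OF cd])
    show "(f x a, g y b) \<in> W" if "(x, y) \<in> G" for x y
      using that \<open>(a, b) \<in> G\<close> by (intro uniform_closure.base G_op)
  qed (use that G_subset in auto)
  show ?thesis
  proof (rule extend[OF ab])
    show "(f x c, g y d) \<in> W" if "(x, y) \<in> G" for x y
      using WG[OF that] by (simp only: comm)
  qed (use W_subset[OF cd] in auto)
qed

lemma W_add: "(a, b) \<in> W \<Longrightarrow> (c, d) \<in> W \<Longrightarrow> (a + c, b + d) \<in> W"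
  by (rule W_binop[of "(+)" "(+)"])
    (auto intro: G_add vector_sublatticeD[OF D] vector_sublatticeD[OF Z] simp: add.commute)

lemma W_sup: "(a, b) \<in> W \<Longrightarrow> (c, d) \<in> W \<Longrightarrow> (sup a c, sup b d) \<in> W"
  by (rule W_binop[of sup sup])
    (simp_all only: G_sup vector_sublatticeD[OF D] vector_sublatticeD[OF Z] abs_sup_diff_le
      sup_commute)

lemma W_scale:
  assumes "(a, b) \<in> W"
  shows "(r *\<^sub>R a, r *\<^sub>R b) \<in> W"
  using assms
proof induction
  case (base a b)
  then show ?case by (intro uniform_closure.base G_scale)
next
  case (limit a b u v)
  show ?case
  \<comment> \<open>The scaled regulators are again a pair of \<open>G\<close>, by
    \<open>G_scale\<close>.\<close>
  proof (rule uniform_closure.limit[of _ _ _ _ "\<bar>r\<bar> *\<^sub>R u" "\<bar>r\<bar> *\<^sub>R v"])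
    fix \<epsilon> :: real assume "\<epsilon> > 0"
    then obtain a' b' where "(r *\<^sub>R a', r *\<^sub>R b') \<in> W" "\<bar>a - a'\<bar> \<le> \<epsilon> *\<^sub>R u" "\<bar>b - b'\<bar> \<le> \<epsilon> *\<^sub>R v"
      using limit.IH by blast
    then show "\<exists>a' b'. (a', b') \<in> W \<and> \<bar>r *\<^sub>R a - a'\<bar> \<le> \<epsilon> *\<^sub>R \<bar>r\<bar> *\<^sub>R u \<and>
        \<bar>r *\<^sub>R b - b'\<bar> \<le> \<epsilon> *\<^sub>R \<bar>r\<bar> *\<^sub>R v"
      by (blast intro: abs_scaleR_diff_le)
  qed (use limit vector_sublatticeD[OF D] vector_sublatticeD[OF Z] G_scale in
      \<open>auto intro: scaleR_nonneg_nonneg\<close>)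
qed

lemma W_uminus: "(a, b) \<in> W \<Longrightarrow> (- a, - b) \<in> W"
  using W_scale[of a b "- 1"] by simp

lemma W_diff: "(a, b) \<in> W \<Longrightarrow> (c, d) \<in> W \<Longrightarrow> (a - c, b - d) \<in> W"
  using W_add[of a b "- c" "- d"] W_uminus by simp

lemma W_inf: "(a, b) \<in> W \<Longrightarrow> (c, d) \<in> W \<Longrightarrow> (inf a c, inf b d) \<in> W"
  unfolding inf_eq_neg_sup by (intro W_uminus W_sup)

lemma W_abs: "(a, b) \<in> W \<Longrightarrow> (\<bar>a\<bar>, \<bar>b\<bar>) \<in> W"
  unfolding abs_lattice by (intro W_uminus W_sup)

lemma W_zero: "(0, 0) \<in> W"
  by (intro uniform_closure.base G_zero)

text \<open>Comparison with arbitrary elements of \<open>G\<close>, rather than with \<open>0\<close> only, is what passes to limits.\<close>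

lemma W_lower_bound:
  assumes "(a, b) \<in> W" "(x, y) \<in> G" "x \<le> a"
  shows "y \<le> b"
  using assms
proof (induction arbitrary: x y)
  case (base a b)
  have "(a - x, b - y) \<in> G"
    using G_add[OF base(1) G_scale[OF base(2), of "- 1"]] by simp
  then show ?case using G_nonneg base(3) by fastforce
next
  case (limit a b u v)
  \<comment> \<open>Two errors \<epsilon> times \<open>v\<close> arise: one from shifting
    \<open>(x, y)\<close> down, one from replacing \<open>b'\<close> by \<open>b\<close>.\<close>
  show ?case
  proof (rule archimedean_le[of "2 *\<^sub>R v"])
    show "0 \<le> 2 *\<^sub>R v" using limit by (simp add: scaleR_nonneg_nonneg)
    fix \<epsilon> :: real assume "\<epsilon> > 0"
    then obtain a' b' where IH: "\<And>x y. (x, y) \<in> G \<Longrightarrow> x \<le> a' \<Longrightarrow> y \<le> b'"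
      and near: "\<bar>a - a'\<bar> \<le> \<epsilon> *\<^sub>R u" "\<bar>b - b'\<bar> \<le> \<epsilon> *\<^sub>R v"
      using limit.IH by blast
    \<comment> \<open>The shift brings the first coordinate below \<open>a'\<close>; because the
      regulators form a pair of \<open>G\<close>, the shifted pair is still a legitimate test
      pair.\<close>
    have "(x - \<epsilon> *\<^sub>R u, y - \<epsilon> *\<^sub>R v) \<in> G"
      using G_add[OF limit.prems(1) G_scale[OF limit.hyps(3), of "- \<epsilon>"]] by simp
    moreover have "x - \<epsilon> *\<^sub>R u \<le> a'"
      using limit.prems(2) abs_le_D1[OF near(1)] by (simp add: algebra_simps)
    ultimately have "y - \<epsilon> *\<^sub>R v \<le> b'" by (rule IH)
    moreover have "b' \<le> b + \<epsilon> *\<^sub>R v"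
      using abs_le_D2[OF near(2)] by (simp add: algebra_simps)
    ultimately have "y - \<epsilon> *\<^sub>R v \<le> b + \<epsilon> *\<^sub>R v" by (rule order_trans)
    then show "y \<le> b + \<epsilon> *\<^sub>R 2 *\<^sub>R v"
      by (simp add: scaleR_2 scaleR_right_distrib algebra_simps)
  qed
qed

lemma W_mono: "(a, b) \<in> W \<Longrightarrow> (c, d) \<in> W \<Longrightarrow> a \<le> c \<Longrightarrow> b \<le> d"
  using W_lower_bound[OF _ G_zero, of "c - a" "d - b"] W_diff by simp

lemma W_functional: "(a, b) \<in> W \<Longrightarrow> (a, d) \<in> W \<Longrightarrow> b = d"
  by (intro antisym) (auto intro: W_mono)

text \<open>Any regulator in the domain can thus be replaced by one from \<open>G\<close>, the only
  kind that the rule \<open>limit\<close> accepts. One approximant, at \<epsilon> = 1, suffices in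
  the limit step.\<close>

lemma W_majorized:
  assumes "(a, b) \<in> W"
  shows "\<exists>u v. (u, v) \<in> G \<and> \<bar>a\<bar> \<le> u"
  using assms
proof induction
  case (base a b)
  then have "(\<bar>a\<bar>, \<bar>b\<bar>) \<in> G"
    unfolding abs_lattice using G_sup[OF base G_scale[OF base, of "- 1"]] by simp
  then show ?case by blast
next
  case (limit a b u v)
  then obtain a' u' v' where *: "(u', v') \<in> G" "\<bar>a'\<bar> \<le> u'" "\<bar>a - a'\<bar> \<le> 1 *\<^sub>R u"
    using limit.IH[of 1] by auto
  then have "\<bar>a\<bar> \<le> u + u'"
    using abs_diff_le_add[of a a' u 0 u'] by simp
  then show ?case using G_add[OF limit.hyps(3) *(1)] by blast
qed

section \<open>The domain of the closure: completeness and minimality\<close>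

lemma Domain_vector_sublattice: "vector_sublattice (Domain W)"
  unfolding vector_sublattice_def subspace_def
  using W_zero by (blast intro: W_add W_scale W_sup W_inf)

text \<open>A Cauchy net \<open>x\<close> in the domain has a partner net \<open>y\<close>, which is
  Cauchy because \<open>W_mono\<close> transports the estimates. Both nets converge, in
  \<open>D\<close> and in \<open>Z\<close>, and the rule \<open>limit\<close> puts the pair of
  limits into the closure.\<close>

lemma Domain_uniformly_complete: "uniformly_complete (Domain W)"
proof (rule uniformly_completeI)
  fix \<Lambda> :: "('a set \<times> 'a) set" and le x e
  assume dir: "directed_index \<Lambda> le" and x: "x ` \<Lambda> \<subseteq> Domain W" and e: "e \<in> Domain W" "0 \<le> e"
    and C: "Cauchy_rel e \<Lambda> le x"
  obtain u v where uv: "(u, v) \<in> G" "e \<le> u"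
    using W_majorized e by fastforce
  then have u: "0 \<le> u" and v: "0 \<le> v" and "u \<in> D" "v \<in> Z"
    using e(2) G_nonneg G_subset by (auto intro: order_trans)
  have "\<forall>\<alpha>\<in>\<Lambda>. \<exists>b. (x \<alpha>, b) \<in> W"
    using x by blast
  then obtain y where y: "\<And>\<alpha>. \<alpha> \<in> \<Lambda> \<Longrightarrow> (x \<alpha>, y \<alpha>) \<in> W"
    using bchoice by metis
  have Cx: "Cauchy_rel u \<Lambda> le x"
    using C uv(2) by (rule Cauchy_rel_mono)
  \<comment> \<open>Both sides are second coordinates of pairs in \<open>W\<close> whose first
    coordinates are already ordered.\<close>
  have "\<bar>y \<beta> - y \<gamma>\<bar> \<le> \<epsilon> *\<^sub>R v" if "\<bar>x \<beta> - x \<gamma>\<bar> \<le> \<epsilon> *\<^sub>R u" "\<beta> \<in> \<Lambda>" "\<gamma> \<in> \<Lambda>" for \<beta> \<gamma> \<epsilon>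
    by (rule W_mono[OF W_abs[OF W_diff[OF y y]] W_scale[OF uniform_closure.base[OF uv(1)]]])
      (use that in auto)
  then have Cy: "Cauchy_rel v \<Lambda> le y"
    using Cx unfolding Cauchy_rel_def by meson
  obtain a where a: "a \<in> D" "converges_rel u \<Lambda> le x a"
    using uniformly_complete_Cauchy_rel[OF D_complete dir _ \<open>u \<in> D\<close> u Cx] y W_subset by blast
  obtain b where b: "b \<in> Z" "converges_rel v \<Lambda> le y b"
    using uniformly_complete_Cauchy_rel[OF Z_complete dir _ \<open>v \<in> Z\<close> v Cy] y W_subset by blast
  have "(a, b) \<in> W"
  proof (rule uniform_closure.limit[OF a(1) b(1) uv(1) u v])
    fix \<epsilon> :: real assume "\<epsilon> > 0"
    then obtain \<alpha> \<beta> where ab: "\<alpha> \<in> \<Lambda>" "\<And>\<gamma>. \<gamma> \<in> \<Lambda> \<Longrightarrow> le \<alpha> \<gamma> \<Longrightarrow> \<bar>x \<gamma> - a\<bar> \<le> \<epsilon> *\<^sub>R u"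
      "\<beta> \<in> \<Lambda>" "\<And>\<gamma>. \<gamma> \<in> \<Lambda> \<Longrightarrow> le \<beta> \<gamma> \<Longrightarrow> \<bar>y \<gamma> - b\<bar> \<le> \<epsilon> *\<^sub>R v"
      using a(2) b(2) unfolding converges_rel_def by meson
    \<comment> \<open>An index beyond both thresholds lets the single pair
      \<open>(x \<gamma>, y \<gamma>)\<close> approximate in both coordinates.\<close>
    then obtain \<gamma> where "\<gamma> \<in> \<Lambda>" "le \<alpha> \<gamma>" "le \<beta> \<gamma>"
      using directed_indexD(3)[OF dir] by meson
    then show "\<exists>a' b'. (a', b') \<in> W \<and> \<bar>a - a'\<bar> \<le> \<epsilon> *\<^sub>R u \<and> \<bar>b - b'\<bar> \<le> \<epsilon> *\<^sub>R v"
      using ab y by (metis abs_minus_commute)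
  qed
  moreover have "u \<in> Domain W"
    using uv(1) by (auto intro: uniform_closure.base)
  ultimately show "\<exists>l\<in>Domain W. \<exists>u\<in>Domain W. 0 \<le> u \<and> converges_rel u \<Lambda> le x l"
    using a(2) u by blast
qed

text \<open>One inclusion is an induction: all regulators lie in \<open>Domain G\<close>, hence in
  each competing \<open>Y\<close>, so \<open>uniformly_complete_approx\<close> applies. For the
  other, \<open>Domain W\<close> is itself a competitor.\<close>

lemma Domain_eq_hull: "Domain W = uniformly_complete_hull D (Domain G)"
proof
  have "a \<in> Y" if Y: "uniformly_complete Y" "Domain G \<subseteq> Y" and "(a, b) \<in> W" for a b Y
    using that(3)
  proof induction
    case (base a b)
    then show ?case using Y by blast
  next
    case (limit a b u v)
    show ?case
    proof (rule uniformly_complete_approx[OF Y(1) _ \<open>0 \<le> u\<close>])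
      show "u \<in> Y" using limit.hyps(3) Y(2) by blast
    qed (use limit.IH in blast)
  qed
  then show "Domain W \<subseteq> uniformly_complete_hull D (Domain G)"
    unfolding uniformly_complete_hull_def by blast
  have "Domain W \<subseteq> D" "Domain G \<subseteq> Domain W"
    using W_subset by (auto intro: uniform_closure.base)
  then show "uniformly_complete_hull D (Domain G) \<subseteq> Domain W"
    unfolding uniformly_complete_hull_def
    using Domain_vector_sublattice Domain_uniformly_complete by blast
qed

end

section \<open>The isomorphism between the two hulls\<close>

theorem (in lattice_correspondence) hull_isomorphism:
  "\<exists>T. lattice_iso_on (uniformly_complete_hull D (Domain G)) (uniformly_complete_hull Z (Range G)) T
     \<and> (\<forall>(a, b)\<in>G. T a = b)"
proof -
  interpret conv: lattice_correspondence Z D "G\<inverse>"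
    by (rule converse_correspondence)
  have Range: "Range W = uniformly_complete_hull Z (Range G)"
    using conv.Domain_eq_hull by (simp add: uniform_closure_converse)
  \<comment> \<open>Injectivity is functionality of the converse closure.\<close>
  have injective: "a = c" if "(a, b) \<in> W" "(c, b) \<in> W" for a b c
    using conv.W_functional[of b a c] that by (simp add: uniform_closure_converse)
  define T where "T a = (THE b. (a, b) \<in> W)" for a
  have T: "T a = b" if "(a, b) \<in> W" for a b
    unfolding T_def using that W_functional by blast
  have T_mem: "(a, T a) \<in> W" if "a \<in> Domain W" for a
    using that T by auto
  have "lattice_hom_on (Domain W) T"
    unfolding lattice_hom_on_def
    by (blast intro: T W_add W_scale W_sup W_inf T_mem)
  moreover have "bij_betw T (Domain W) (Range W)"
    unfolding bij_betw_def
  proof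
    show "inj_on T (Domain W)"
      by (rule inj_onI) (metis T_mem injective)
    show "T ` Domain W = Range W"
      using T T_mem by (fastforce simp: image_iff)
  qed
  moreover have "\<forall>(a, b)\<in>G. T a = b"
    by (auto intro: T uniform_closure.base)
  ultimately show ?thesis
    unfolding lattice_iso_on_def Range[symmetric] Domain_eq_hull[symmetric] by blast
qed

theorem theorem6p1:
  fixes X Z :: "'z::archimedean_vector_lattice set"
    and D :: "'d::archimedean_vector_lattice set"
    and j :: "'z \<Rightarrow> 'd"
  assumes "vector_sublattice Z" and "uniformly_complete Z"
    and "vector_sublattice X" and "X \<subseteq> Z"
    and "order_completion X D j"
  shows "\<exists>T. lattice_iso_on (uniform_completion X D j) (uniformly_complete_hull Z X) T \<and>
             (\<forall>x\<in>X. T (j x) = x)"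
proof -
  \<comment> \<open>Pairs are oriented from \<open>D\<close> to \<open>Z\<close>, so that the
    resulting map sends \<open>j x\<close> back to \<open>x\<close>.\<close>
  define G where "G = (\<lambda>x. (j x, x)) ` X"
  note X = vector_sublatticeD[OF assms(3)]
  have D: "vector_sublattice D" "order_complete D" and inj: "inj_on j X" and jD: "j ` X \<subseteq> D"
    and hom: "lattice_hom_on X j"
    using assms(5) by (auto simp: order_completion_def)
  have j: "\<And>x y. x \<in> X \<Longrightarrow> y \<in> X \<Longrightarrow> j (x + y) = j x + j y"
    "\<And>c x. x \<in> X \<Longrightarrow> j (c *\<^sub>R x) = c *\<^sub>R j x"
    "\<And>x y. x \<in> X \<Longrightarrow> y \<in> X \<Longrightarrow> j (sup x y) = sup (j x) (j y)"
    using hom unfolding lattice_hom_on_def by blast+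
  have j0: "j 0 = 0"
    using j(2)[OF X(1), of 0] by simp
  \<comment> \<open>Positivity of \<open>x\<close> is the equation \<open>sup x 0 = x\<close>, which
    an injective lattice homomorphism preserves and reflects.\<close>
  have nonneg: "0 \<le> j x \<longleftrightarrow> 0 \<le> x" if "x \<in> X" for x
  proof -
    have "0 \<le> j x \<longleftrightarrow> j (sup x 0) = j x"
      using j(3)[OF that X(1)] j0 by (simp add: le_iff_sup sup_commute)
    also have "\<dots> \<longleftrightarrow> sup x 0 = x"
      using inj that X by (auto dest: inj_onD)
    also have "\<dots> \<longleftrightarrow> 0 \<le> x" by (simp add: le_iff_sup sup_commute)
    finally show ?thesis .
  qed
  have "(0, 0) \<in> G"
    unfolding G_def using X(1) j0 by force
  then interpret lattice_correspondence D Z G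
    using assms(1,2,4) D order_complete_uniformly_complete[OF D] jD X
    by unfold_locales (auto simp: G_def j nonneg image_iff)
  have "Domain G = j ` X" "Range G = X"
    by (auto simp: G_def)
  then show ?thesis
    using hull_isomorphism by (auto simp: uniform_completion_def G_def)
qed

end
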